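(* Let $k$ be an infinite field, $R=k[x_1,\ldots,x_n]$, and let $I\subsetneq R$ be a Borel-fixed monomial ideal. Assume that $$\dim_k(R/I)_t<\binom{s+t}{t}$$ for some integers $s,t\ge 1$ with $s\le n$. Then $x_{n-s+1},\ldots,x_n$ generate a reduction of $R/I$ with $$r_{(x_{n-s+1},\ldots,x_n)}(R/I)\le t-1.$$
   Context: A monomial ideal $I$ of $R=k[x_1,\ldots,x_n]$ is called Borel-fixed if $g(I)=I$ for all $g$ in the Borel subgroup $\mathcal B\subset \mathrm{GL}(n,k)$ of upper triangular invertible matrices; here $g=(g_{ij})$ acts as the $k$-algebra automorphism of $R$ with $g(x_j)=\sum_{i\le j} g_{ij}x_i$. An ideal $Q\subset R$ generated by linear forms is said to generate a reduction of $R/I$ if $(Q+I)_t=R_t$ for all $t$ large enough; in that case its reduction number $r_Q(R/I)$ is the minimum integer $r\ge 0$ such that $(Q+I)_{r+1}=R_{r+1}$. *)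

theory Defs
  imports
    "HOL-Library.Poly_Mapping"
    "HOL-Algebra.QuotRing"
    "HOL-Algebra.Embedded_Algebras"
    "Jordan_Normal_Form.Matrix"
begin

text \<open>
  A monomial is an exponent vector \<open>nat \<Rightarrow>\<^sub>0 nat\<close> and a polynomial a finitely supported family of
  coefficients. The ring \<open>k[x\<^sub>1,\<dots>,x\<^sub>n]\<close> is the subring of those polynomials that only involve
  the variables with index in \<open>{1..n}\<close>.
\<close>

type_synonym monomial = "nat \<Rightarrow>\<^sub>0 nat"
type_synonym 'a mpoly = "monomial \<Rightarrow>\<^sub>0 'a"

definition monomials :: "nat \<Rightarrow> monomial set" where
  "monomials n = {m. Poly_Mapping.keys m \<subseteq> {1..n}}"

definition mdeg :: "monomial \<Rightarrow> nat" where
  "mdeg m = (\<Sum>j\<in>Poly_Mapping.keys m. Poly_Mapping.lookup m j)"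

definition pmonom :: "monomial \<Rightarrow> 'a::field mpoly" where
  "pmonom m = Poly_Mapping.single m 1"

definition pconst :: "'a::field \<Rightarrow> 'a mpoly" where
  "pconst c = Poly_Mapping.single 0 c"

definition pvar :: "nat \<Rightarrow> 'a::field mpoly" where
  "pvar j = pmonom (Poly_Mapping.single j 1)"

definition poly_ring :: "nat \<Rightarrow> 'a::field mpoly ring" where
  "poly_ring n = \<lparr>carrier = {p. Poly_Mapping.keys p \<subseteq> monomials n},
     monoid.mult = (*), one = 1, zero = 0, add = (+)\<rparr>"

text \<open>The graded piece \<open>R\<^sub>t\<close>; it contains \<open>0\<close>.\<close>

definition homog :: "nat \<Rightarrow> nat \<Rightarrow> 'a::field mpoly set" where
  "homog n t = {p \<in> carrier (poly_ring n). \<forall>m\<in>Poly_Mapping.keys p. mdeg m = t}"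

text \<open>
  The dimension of \<open>(R/I)\<^sub>t\<close> over \<open>k\<close>. Here \<open>(R/I)\<^sub>t\<close> is the image of \<open>R\<^sub>t\<close> in the quotient ring,
  and \<open>k\<close> acts through its image there, which is a subfield if \<open>I\<close> is a proper ideal.
\<close>

definition quot_dim :: "nat \<Rightarrow> 'a::field mpoly set \<Rightarrow> nat \<Rightarrow> nat" where
  "quot_dim n I t =
     ring.dim (poly_ring n Quot I)
       ((\<lambda>c. I +>\<^bsub>poly_ring n\<^esub> pconst c) ` UNIV)
       ((\<lambda>f. I +>\<^bsub>poly_ring n\<^esub> f) ` homog n t)"

definition monomial_ideal :: "nat \<Rightarrow> 'a::field mpoly set \<Rightarrow> bool" where
  "monomial_ideal n I \<longleftrightarrow> (\<exists>M \<subseteq> monomials n. I = Idl\<^bsub>poly_ring n\<^esub> (pmonom ` M))"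

text \<open>
  The action of \<open>g\<close> by the \<open>k\<close>-algebra homomorphism \<open>x\<^sub>j \<mapsto> \<Sum>i\<le>j. g\<^sub>i\<^sub>j x\<^sub>i\<close>. Matrix entries are indexed
  from \<open>0\<close>, variables from \<open>1\<close>.
\<close>

definition borel_act :: "'a::field mat \<Rightarrow> 'a mpoly \<Rightarrow> 'a mpoly" where
  "borel_act g p =
     (\<Sum>m\<in>Poly_Mapping.keys p. pconst (Poly_Mapping.lookup p m) *
        (\<Prod>j\<in>Poly_Mapping.keys m.
           (\<Sum>i\<in>{1..j}. pconst (g $$ (i - 1, j - 1)) * pvar i) ^ Poly_Mapping.lookup m j))"

definition borel_group :: "nat \<Rightarrow> 'a::field mat set" where
  "borel_group n = {g \<in> carrier_mat n n. upper_triangular g \<and> invertible_mat g}"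

definition borel_fixed :: "nat \<Rightarrow> 'a::field mpoly set \<Rightarrow> bool" where
  "borel_fixed n I \<longleftrightarrow> monomial_ideal n I \<and> (\<forall>g \<in> borel_group n. borel_act g ` I = I)"

definition generates_reduction :: "nat \<Rightarrow> 'a::field mpoly set \<Rightarrow> 'a mpoly set \<Rightarrow> bool" where
  "generates_reduction n I Q \<longleftrightarrow>
     (\<exists>L \<subseteq> homog n 1. Q = Idl\<^bsub>poly_ring n\<^esub> L) \<and>
     (\<exists>t0. \<forall>t\<ge>t0. (Q <+>\<^bsub>poly_ring n\<^esub> I) \<inter> homog n t = homog n t)"

text \<open>Only meaningful if \<open>Q\<close> generates a reduction of \<open>R/I\<close>.\<close>

definition reduction_number :: "nat \<Rightarrow> 'a::field mpoly set \<Rightarrow> 'a mpoly set \<Rightarrow> nat" where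
  "reduction_number n I Q =
     (LEAST r. (Q <+>\<^bsub>poly_ring n\<^esub> I) \<inter> homog n (r + 1) = homog n (r + 1))"

end

theory Submission
  imports Defs "Jordan_Normal_Form.Gauss_Jordan_Elimination"
begin

text \<open>
  Modulo \<open>Q = (x\<^sub>n\<^sub>-\<^sub>s\<^sub>+\<^sub>1, \<dots>, x\<^sub>n)\<close> only the monomials in \<open>x\<^sub>1, \<dots>, x\<^sub>n\<^sub>-\<^sub>s\<close> survive. If all those of degree \<open>t\<close>
  lie in \<open>I\<close>, then so do their multiples, hence \<open>Q + I\<close> contains \<open>R\<^sub>d\<close> for every \<open>d \<ge> t\<close>, which gives
  both assertions (\<open>homog_subset_variables_plus_ideal\<close>). So it suffices to show that a single monomial
  \<open>m \<notin> I\<close> of degree \<open>t\<close> in the first \<open>n - s\<close> variables forces \<open>dim (R/I)\<^sub>t \<ge> (s + t) choose s\<close>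
  (\<open>quot_dim_ge_binomial\<close>).

  For a monomial ideal that dimension is the number of monomials of degree \<open>t\<close> outside \<open>I\<close>
  (\<open>quot_dim_monomial_ideal\<close>), so many monomials outside \<open>I\<close> have to be constructed from \<open>m\<close>. Let \<open>i < j\<close>.
  The substitution \<open>x\<^sub>j \<mapsto> x\<^sub>j + x\<^sub>i\<close> belongs to the Borel group, and it maps \<open>r x\<^sub>j\<^sup>b\<close>, with \<open>r\<close> free of \<open>x\<^sub>j\<close>,
  to a polynomial in which \<open>r x\<^sub>i\<^sup>b\<close> has coefficient \<open>1\<close>. So if \<open>r x\<^sub>i\<^sup>b\<close> is outside \<open>I\<close>, then so is \<open>r x\<^sub>j\<^sup>b\<close>
  (\<open>borel_fixed_exchange\<close>). In characteristic \<open>0\<close> one could collect all of \<open>m\<close> in \<open>x\<^sub>n\<^sub>-\<^sub>s\<^sup>t\<close> and then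
  spread it arbitrarily over \<open>x\<^sub>n\<^sub>-\<^sub>s, \<dots>, x\<^sub>n\<close>, but in characteristic \<open>p\<close> the coefficients that occur
  may vanish. The moves that are always available take a part of the exponent of some \<open>x\<^sub>i\<close> to a
  variable \<open>x\<^sub>j\<close> that does not yet occur.

  These moves already suffice. Call \<open>1, \<dots>, n - s\<close> the rows and \<open>n - s + 1, \<dots>, n\<close> the columns. Empty
  the rows one after the other, each down to a chosen remainder, and let each row use a consecutive
  block of columns. Different choices give different monomials, and Pascal's rule counts them:
  there are at least as many as monomials of degree \<open>t\<close> in \<open>s + 1\<close> variables
  (\<open>card_redistributions_ge\<close>).
\<close>

section \<open>Redistributing an exponent vector over fresh variables\<close>

text \<open>
  Exponent vectors are plain functions here, so that single entries can be updated freely. The set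
  \<open>P\<close> will be the set of monomials outside a Borel-fixed ideal.
\<close>

definition redistributions :: "('a \<Rightarrow> nat) set \<Rightarrow> ('a \<Rightarrow> nat) \<Rightarrow> 'a set \<Rightarrow> ('a \<Rightarrow> nat) set" where
  "redistributions P m A = {f \<in> P. (\<forall>x. x \<notin> A \<longrightarrow> f x = m x) \<and> sum f A = sum m A}"

text \<open>
  A part \<open>b\<close> of the exponent at a row \<open>i \<in> A\<close> may be moved to a column \<open>j \<in> B\<close>, but only if column
  \<open>j\<close> is still empty. If \<open>j\<close> could already be occupied, then in positive characteristic the binomial
  coefficient that justifies the move might vanish.
\<close>

definition spread_closed :: "'a set \<Rightarrow> 'a set \<Rightarrow> ('a \<Rightarrow> nat) set \<Rightarrow> bool" where
  "spread_closed A B P \<longleftrightarrow>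
     (\<forall>f\<in>P. \<forall>i\<in>A. \<forall>j\<in>B. \<forall>b\<le>f i. f j = 0 \<longrightarrow> f(i := f i - b, j := b) \<in> P)"

lemma finite_redistributions:
  assumes "finite A"
  shows "finite (redistributions P m A)"
proof (rule inj_on_finite)
  show "inj_on (\<lambda>f. restrict f A) (redistributions P m A)"
  proof (rule inj_onI, rule ext)
    fix f g x
    assume "f \<in> redistributions P m A" "g \<in> redistributions P m A" "restrict f A = restrict g A"
    then show "f x = g x"
      by (cases "x \<in> A") (auto simp: redistributions_def dest: fun_cong[of _ _ x])
  qed
  have "f x \<le> sum m A" if "f \<in> redistributions P m A" "x \<in> A" for f x
    using member_le_sum[of x A f] assms that by (simp add: redistributions_def)
  then show "(\<lambda>f. restrict f A) ` redistributions P m A \<subseteq> PiE A (\<lambda>_. {..sum m A})"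
    by auto
  show "finite (PiE A (\<lambda>_. {..sum m A}))"
    using assms by (intro finite_PiE) auto
qed

text \<open>
  The counting scheme of both inductions below: \<open>S\<close> is cut into slices \<open>T w\<close>, kept apart by the value
  of \<open>key\<close>, and the slice \<open>T w\<close> is only known to be at least as large as the increment
  \<open>F w - F (w - 1)\<close>. The increments telescope.
\<close>

lemma card_ge_by_increments:
  fixes F :: "nat \<Rightarrow> nat"
  assumes fin: "finite S"
    and sub: "\<And>w. w \<le> u \<Longrightarrow> T w \<subseteq> S"
    and key: "\<And>w x. w \<le> u \<Longrightarrow> x \<in> T w \<Longrightarrow> key x + w = u"
    and zero: "F 0 \<le> card (T 0)"
    and step: "\<And>w. w < u \<Longrightarrow> F (Suc w) \<le> F w + card (T (Suc w))"
  shows "F u \<le> card S"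
proof -
  have "F w \<le> (\<Sum>k\<le>w. card (T k))" if "w \<le> u" for w
    using that
  proof (induction w)
    case 0
    then show ?case using zero by simp
  next
    case (Suc w)
    then show ?case using step[of w] by simp
  qed
  then have "F u \<le> (\<Sum>k\<le>u. card (T k))" by simp
  also have "\<dots> = card (\<Union>k\<le>u. T k)"
  proof (rule card_UN_disjoint[symmetric])
    show "\<forall>k\<in>{..u}. finite (T k)"
      using sub fin finite_subset by blast
    show "\<forall>k\<in>{..u}. \<forall>l\<in>{..u}. k \<noteq> l \<longrightarrow> T k \<inter> T l = {}"
    proof (intro ballI impI equals0I)
      fix k l x assume "k \<in> {..u}" "l \<in> {..u}" "k \<noteq> l" "x \<in> T k \<inter> T l"
      then show False using key[of k x] key[of l x] by auto
    qed
  qed simp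
  also have "\<dots> \<le> card S"
    using fin sub by (intro card_mono) auto
  finally show ?thesis .
qed

text \<open>
  Of a row holding \<open>v + (u + 1)\<close> exactly \<open>v\<close> is to stay. The asserted lower bound is the difference
  of the binomial coefficients for \<open>u + 1\<close> and \<open>u\<close>, in additive form so that it also makes sense
  without columns.

  The proof is an induction on the columns. The first column \<open>j\<close> receives some amount from row \<open>i\<close>, so
  that \<open>w\<close> still has to leave the row, and it is never touched again; different \<open>w\<close> give different
  values at \<open>j\<close>. For \<open>w = 0\<close> the row is finished and the remaining columns serve the other rows
  (the hypothesis \<open>rest\<close>); for \<open>w > 0\<close> the induction hypothesis applies. By Pascal's rule the
  increments contributed by these slices sum to the right amount.
\<close>

lemma card_redistributions_prescribed_row:
  assumes P: "spread_closed A B P"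
    and rows: "finite rs" "i \<in> A" "i \<notin> rs" "i \<notin> B" "rs \<inter> B = {}"
    and rest: "\<And>m cs. m \<in> P \<Longrightarrow> finite cs \<Longrightarrow> cs \<subseteq> B \<Longrightarrow> (\<And>x. x \<in> cs \<Longrightarrow> m x = 0) \<Longrightarrow>
      (card cs + sum m rs) choose card cs \<le> card (redistributions P m (rs \<union> cs))"
    and "finite cs" "cs \<subseteq> B" "m \<in> P" "\<And>x. x \<in> cs \<Longrightarrow> m x = 0" "m i = v + Suc u"
  shows "(card cs + sum m rs + Suc u) choose card cs
    \<le> ((card cs + sum m rs + u) choose card cs)
      + card {f \<in> redistributions P m (insert i rs \<union> cs). f i = v}"
  using assms(8-)
proof (induction cs arbitrary: m u rule: finite_induct)
  case empty
  then show ?case by simp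
next
  case (insert j cs)
  note m = insert.prems
  from m have j: "j \<in> B" "j \<notin> cs" "m j = 0" using insert.hyps by auto
  have ij: "i \<noteq> j" "j \<notin> rs" "i \<notin> cs" using j rows m by auto
  define c where "c = card cs"
  define S where "S = {f \<in> redistributions P m (insert i rs \<union> insert j cs). f i = v}"
  have finS: "finite S"
    unfolding S_def using finite_redistributions[of "insert i rs \<union> insert j cs"] rows insert.hyps by simp
  \<comment> \<open>column \<open>j\<close> has received its share, and \<open>w\<close> is still to be removed from row \<open>i\<close>\<close>
  define m' where "m' w = m(i := v + w, j := Suc u - w)" for w
  have m'P: "m' w \<in> P" if "w \<le> Suc u" for w
  proof -
    have "Suc u - w \<le> m i" using m(4) by simp
    then have "m(i := m i - (Suc u - w), j := Suc u - w) \<in> P"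
      using P m(2) j rows(2) unfolding spread_closed_def by blast
    moreover have "m i - (Suc u - w) = v + w" using m(4) that by simp
    ultimately show ?thesis unfolding m'_def by simp
  qed
  have m'0: "m' w x = 0" if "x \<in> cs" for w x
    using m(3) that ij j unfolding m'_def by auto
  have m'sum: "sum (m' w) rs = sum m rs" for w
    unfolding m'_def using ij rows by (intro sum.cong) auto
  have fin: "finite rs" "finite cs" using rows insert.hyps by auto
  have total: "sum f (insert i rs \<union> insert j cs) = f i + (f j + sum f (rs \<union> cs))" for f :: "'a \<Rightarrow> nat"
  proof -
    have "insert i rs \<union> insert j cs = insert i (insert j (rs \<union> cs))" by auto
    moreover have "i \<notin> insert j (rs \<union> cs)" "j \<notin> rs \<union> cs" using ij j rows by auto
    ultimately show ?thesis using fin by (simp del: Un_insert_right)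
  qed
  have m'sum2: "sum (m' w) (rs \<union> cs) = sum m (rs \<union> cs)" for w
    unfolding m'_def using ij j rows by (intro sum.cong) auto
  define T where "T w = {f \<in> redistributions P (m' w) (insert i rs \<union> cs). f i = v}" for w
  have Tsub: "T w \<subseteq> S" and Tkey: "\<And>f. f \<in> T w \<Longrightarrow> f j + w = Suc u" if w: "w \<le> Suc u" for w
  proof -
    have *: "f j = Suc u - w" "f \<in> S" if "f \<in> T w" for f
    proof -
      have f: "f \<in> P" "f i = v" "\<And>x. x \<notin> insert i (rs \<union> cs) \<Longrightarrow> f x = m' w x"
        "sum f (insert i (rs \<union> cs)) = sum (m' w) (insert i (rs \<union> cs))"
        using that unfolding T_def redistributions_def by auto
      have "i \<notin> rs \<union> cs" using rows ij by auto
      then have f4: "f i + sum f (rs \<union> cs) = v + w + sum m (rs \<union> cs)"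
        using f(4) fin m'sum2[of w] ij by (simp add: m'_def)
      show fj: "f j = Suc u - w"
        using f(3)[of j] ij j rows unfolding m'_def by auto
      have "f x = m x" if "x \<notin> insert i rs \<union> insert j cs" for x
        using f(3)[of x] that by (auto simp: m'_def)
      moreover have "sum f (insert i rs \<union> insert j cs) = sum m (insert i rs \<union> insert j cs)"
        unfolding total using f4 fj w m(4) j(3) f(2) by linarith
      ultimately show "f \<in> S" using f unfolding S_def redistributions_def by blast
    qed
    show "T w \<subseteq> S" using * by blast
    show "f j + w = Suc u" if "f \<in> T w" for f using *(1)[OF that] w by simp
  qed
  have "(c + sum m rs + Suc u) choose c \<le> card S"
  proof (rule card_ge_by_increments[where F = "\<lambda>w. (c + sum m rs + w) choose c" and T = T
        and key = "\<lambda>f. f j" and u = "Suc u"])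
    have "redistributions P (m' 0) (rs \<union> cs) \<subseteq> T 0"
    proof
      fix f assume f: "f \<in> redistributions P (m' 0) (rs \<union> cs)"
      have "i \<notin> rs \<union> cs" using rows ij by auto
      then show "f \<in> T 0"
        using f fin ij by (auto simp: T_def redistributions_def m'_def)
    qed
    moreover have "finite (T 0)" using Tsub[of 0] finS finite_subset by auto
    ultimately have "card (redistributions P (m' 0) (rs \<union> cs)) \<le> card (T 0)"
      by (simp add: card_mono)
    moreover have "(c + sum m rs) choose c \<le> card (redistributions P (m' 0) (rs \<union> cs))"
      using rest[of "m' 0" cs] m'P[of 0] m'0 m'sum m insert.hyps by (simp add: c_def)
    ultimately show "(c + sum m rs + 0) choose c \<le> card (T 0)" by simp
  next
    fix w assume w: "w < Suc u"
    have "m' (Suc w) i = v + Suc w" using ij by (simp add: m'_def)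
    then have "(card cs + sum (m' (Suc w)) rs + Suc w) choose card cs
      \<le> ((card cs + sum (m' (Suc w)) rs + w) choose card cs) + card (T (Suc w))"
      unfolding T_def using m(1) m'P[of "Suc w"] m'0 w by (intro insert.IH) auto
    then show "(c + sum m rs + Suc w) choose c \<le> ((c + sum m rs + w) choose c) + card (T (Suc w))"
      by (simp add: c_def m'sum)
  qed (use finS Tsub Tkey in auto)
  moreover have "card (insert j cs) = Suc c" using insert.hyps c_def by simp
  ultimately show ?case unfolding S_def by simp
qed

text \<open>
  The number of monomials of degree \<open>t\<close> in \<open>s + 1\<close> variables is \<open>(s + t) choose s\<close>, and this is what
  one gets when all of the degree \<open>t\<close> sits in a single row and is spread over \<open>s\<close> columns. With several
  rows the bound survives: slice by the value that is finally left in row \<open>i\<close>; a prescribed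
  row contributes the increment of the previous lemma, and an untouched row leaves all columns
  to the other rows.
\<close>

lemma card_redistributions_ge:
  assumes P: "spread_closed A B P" and "A \<inter> B = {}"
    and "finite rs" "rs \<subseteq> A"
    and "m \<in> P" "finite cs" "cs \<subseteq> B" "\<And>x. x \<in> cs \<Longrightarrow> m x = 0"
  shows "(card cs + sum m rs) choose card cs \<le> card (redistributions P m (rs \<union> cs))"
  using assms(3-)
proof (induction rs arbitrary: m cs rule: finite_induct)
  case empty
  have "m \<in> redistributions P m cs" using empty by (simp add: redistributions_def)
  moreover have "finite (redistributions P m cs)" using empty finite_redistributions by blast
  ultimately have "redistributions P m cs \<noteq> {}" "finite (redistributions P m cs)" by auto
  then have "Suc 0 \<le> card (redistributions P m cs)" by (simp add: Suc_le_eq card_gt_0_iff)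
  then show ?case by simp
next
  case (insert i rs)
  note m = insert.prems
  have i: "i \<in> A" "i \<notin> B" "rs \<inter> B = {}" "i \<notin> cs" using assms(2) m by auto
  define c where "c = card cs"
  define T where "T w = {f \<in> redistributions P m (insert i rs \<union> cs). f i = m i - w}" for w
  let ?S = "redistributions P m (insert i rs \<union> cs)"
  have finS: "finite ?S" using m insert.hyps by (intro finite_redistributions) auto
  have "(c + sum m rs + m i) choose c \<le> card ?S"
  proof (rule card_ge_by_increments[where F = "\<lambda>w. (c + sum m rs + w) choose c" and T = T
        and key = "\<lambda>f. f i"])
    show "finite ?S" by (rule finS)
    have "redistributions P m (rs \<union> cs) \<subseteq> T 0"
    proof
      fix f assume f: "f \<in> redistributions P m (rs \<union> cs)"
      have "i \<notin> rs \<union> cs" using insert.hyps i by auto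
      then show "f \<in> T 0"
        using f m(3) insert.hyps by (auto simp: T_def redistributions_def)
    qed
    moreover have "finite (T 0)" using finS by (simp add: T_def)
    ultimately have "card (redistributions P m (rs \<union> cs)) \<le> card (T 0)"
      by (simp add: card_mono)
    moreover have "(c + sum m rs) choose c \<le> card (redistributions P m (rs \<union> cs))"
      using insert.IH[of m cs] m by (simp add: c_def)
    ultimately show "(c + sum m rs + 0) choose c \<le> card (T 0)" by simp
  next
    fix w assume w: "w < m i"
    show "(c + sum m rs + Suc w) choose c \<le> ((c + sum m rs + w) choose c) + card (T (Suc w))"
      unfolding T_def c_def
    proof (rule card_redistributions_prescribed_row[OF P])
      fix m' cs'
      assume "m' \<in> P" "finite cs'" "cs' \<subseteq> B" "\<And>x. x \<in> cs' \<Longrightarrow> m' x = 0"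
      then show "(card cs' + sum m' rs) choose card cs' \<le> card (redistributions P m' (rs \<union> cs'))"
        using insert.IH m(1) by blast
    qed (use i m insert.hyps w in auto)
  qed (auto simp: T_def)
  moreover have "sum m (insert i rs) = sum m rs + m i" using insert.hyps by simp
  ultimately show ?case unfolding c_def by (simp add: add.assoc)
qed

section \<open>The polynomial ring and its monomial ideals\<close>

lemma zero_in_monomials: "0 \<in> monomials n"
  by (simp add: monomials_def)

lemma plus_in_monomials_iff: "a + b \<in> monomials n \<longleftrightarrow> a \<in> monomials n \<and> b \<in> monomials n"
  by (auto simp: monomials_def in_keys_iff lookup_add subset_iff)

lemma poly_ring_simps:
  "carrier (poly_ring n) = {p. Poly_Mapping.keys p \<subseteq> monomials n}"
  "x \<otimes>\<^bsub>poly_ring n\<^esub> y = x * y" "x \<oplus>\<^bsub>poly_ring n\<^esub> y = x + y"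
  "\<one>\<^bsub>poly_ring n\<^esub> = 1" "\<zero>\<^bsub>poly_ring n\<^esub> = 0"
  by (simp_all add: poly_ring_def)

lemma cring_poly_ring: "cring (poly_ring n :: 'a::field mpoly ring)"
proof (rule cringI)
  show "abelian_group (poly_ring n :: 'a mpoly ring)"
  proof (rule abelian_groupI)
    fix x :: "'a mpoly" assume "x \<in> carrier (poly_ring n)"
    then show "\<exists>y\<in>carrier (poly_ring n). y \<oplus>\<^bsub>poly_ring n\<^esub> x = \<zero>\<^bsub>poly_ring n\<^esub>"
      by (intro bexI[of _ "- x"]) (auto simp: poly_ring_simps)
  next
    fix x y :: "'a mpoly" assume "x \<in> carrier (poly_ring n)" "y \<in> carrier (poly_ring n)"
    then show "x \<oplus>\<^bsub>poly_ring n\<^esub> y \<in> carrier (poly_ring n)"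
      using keys_add[of x y] by (auto simp: poly_ring_simps)
  qed (auto simp: poly_ring_simps add_ac)
  show "comm_monoid (poly_ring n :: 'a mpoly ring)"
  proof (rule comm_monoidI)
    fix x y :: "'a mpoly" assume "x \<in> carrier (poly_ring n)" "y \<in> carrier (poly_ring n)"
    then show "x \<otimes>\<^bsub>poly_ring n\<^esub> y \<in> carrier (poly_ring n)"
      using keys_mult[of x y] by (fastforce simp: poly_ring_simps plus_in_monomials_iff)
  qed (auto simp: poly_ring_simps mult_ac zero_in_monomials)
qed (simp add: poly_ring_simps algebra_simps)

lemma single_in_carrier: "m \<in> monomials n \<Longrightarrow> Poly_Mapping.single m c \<in> carrier (poly_ring n)"
  by (simp add: poly_ring_simps)

lemma pmonom_in_carrier: "m \<in> monomials n \<Longrightarrow> pmonom m \<in> carrier (poly_ring n)"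
  by (simp add: poly_ring_simps pmonom_def)

lemma sum_single_keys: "(\<Sum>m\<in>Poly_Mapping.keys p. Poly_Mapping.single m (Poly_Mapping.lookup p m)) = p"
proof (rule poly_mapping_eqI)
  fix k
  show "Poly_Mapping.lookup (\<Sum>m\<in>Poly_Mapping.keys p. Poly_Mapping.single m (Poly_Mapping.lookup p m)) k
    = Poly_Mapping.lookup p k"
    by (cases "k \<in> Poly_Mapping.keys p")
      (auto simp: lookup_sum lookup_single when_def in_keys_iff)
qed

lemma ideal_mem_if_monomials_mem:
  fixes J :: "'a::field mpoly set"
  assumes "ideal J (poly_ring n)" "p \<in> carrier (poly_ring n)"
    and "\<And>m. m \<in> Poly_Mapping.keys p \<Longrightarrow> pmonom m \<in> J"
  shows "p \<in> J"
proof -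
  interpret J: ideal J "poly_ring n" by fact
  have "Poly_Mapping.single m (Poly_Mapping.lookup p m) \<in> J" if "m \<in> Poly_Mapping.keys p" for m
  proof -
    have "Poly_Mapping.single 0 (Poly_Mapping.lookup p m) \<otimes>\<^bsub>poly_ring n\<^esub> pmonom m \<in> J"
      using assms that zero_in_monomials by (intro J.I_l_closed single_in_carrier) auto
    then show ?thesis by (simp add: poly_ring_simps pmonom_def mult_single)
  qed
  moreover have "(\<Sum>m\<in>S. Poly_Mapping.single m (Poly_Mapping.lookup p m)) \<in> J"
    if "finite S" "\<And>m. m \<in> S \<Longrightarrow> Poly_Mapping.single m (Poly_Mapping.lookup p m) \<in> J" for S
    using that
  proof (induction S rule: finite_induct)
    case empty
    show ?case
      using additive_subgroup.zero_closed[OF J.additive_subgroup_axioms] by (simp add: poly_ring_simps)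
  next
    case (insert x F)
    then show ?case 
      using additive_subgroup.a_closed[OF J.additive_subgroup_axioms] by (simp add: poly_ring_simps)
  qed
  ultimately show ?thesis using sum_single_keys[of p] by (metis finite_keys)
qed

lemma ideal_multiples_mem:
  assumes "ideal J (poly_ring n)" "pmonom a \<in> J" "b \<in> monomials n"
  shows "pmonom (a + b) \<in> J"
proof -
  have "pmonom a \<otimes>\<^bsub>poly_ring n\<^esub> pmonom b \<in> J"
    using ideal.I_r_closed[OF assms(1,2)] pmonom_in_carrier[OF assms(3)] by blast
  then show ?thesis by (simp add: poly_ring_simps pmonom_def mult_single)
qed

lemma monomial_ideal_is_ideal:
  assumes "monomial_ideal n I"
  shows "ideal I (poly_ring n)"
proof -
  interpret cring "poly_ring n :: 'a::field mpoly ring" by (rule cring_poly_ring)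
  obtain M where M: "M \<subseteq> monomials n" "I = Idl\<^bsub>poly_ring n\<^esub> (pmonom ` M)"
    using assms unfolding monomial_ideal_def by blast
  then show ?thesis using genideal_ideal[of "pmonom ` M"] pmonom_in_carrier by blast
qed

text \<open>The multiples of the generating monomials span an ideal, which therefore contains \<open>I\<close>.\<close>

lemma monomial_ideal_keys_mem:
  fixes I :: "'a::field mpoly set"
  assumes I: "monomial_ideal n I" and p: "p \<in> I" "m \<in> Poly_Mapping.keys p"
  shows "pmonom m \<in> I"
proof -
  interpret cring "poly_ring n :: 'a mpoly ring" by (rule cring_poly_ring)
  obtain M where M: "M \<subseteq> monomials n" "I = Idl\<^bsub>poly_ring n\<^esub> (pmonom ` M)"
    using I unfolding monomial_ideal_def by blast
  have idI: "ideal I (poly_ring n)" using I by (rule monomial_ideal_is_ideal)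
  \<comment> \<open>\<open>U\<close> collects the multiples of the generators; \<open>J\<close> is the space they span\<close>
  define U where "U = {a + b |a b. a \<in> M \<and> b \<in> monomials n}"
  define J :: "'a mpoly set" where "J = {p. Poly_Mapping.keys p \<subseteq> U}"
  have Un: "U \<subseteq> monomials n" using M by (auto simp: U_def plus_in_monomials_iff)
  have U_add: "a + b \<in> U" if a: "a \<in> U" and b: "b \<in> monomials n" for a b
  proof -
    obtain a1 a2 where "a = a1 + a2" "a1 \<in> M" "a2 \<in> monomials n" using a unfolding U_def by blast
    then show ?thesis using b unfolding U_def
      by (metis (mono_tags, lifting) add.assoc mem_Collect_eq plus_in_monomials_iff)
  qed
  have mult: "x * y \<in> J" if "x \<in> J" "y \<in> carrier (poly_ring n)" for x y
    using that keys_mult[of x y] U_add by (fastforce simp: J_def poly_ring_simps)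
  have "ideal J (poly_ring n)"
  proof (rule idealI)
    show "ring (poly_ring n :: 'a mpoly ring)" by (rule ring_axioms)
    show "subgroup J (add_monoid (poly_ring n))"
    proof (rule add.subgroupI)
      show "J \<subseteq> carrier (poly_ring n)" using Un by (auto simp: J_def poly_ring_simps)
      have "0 \<in> J" by (simp add: J_def)
      then show "J \<noteq> {}" by blast
    next
      fix a assume "a \<in> J"
      then have *: "- a \<in> J" by (simp add: J_def)
      moreover have "\<ominus>\<^bsub>poly_ring n\<^esub> a = - a"
      proof (rule minus_equality)
        show "a \<in> carrier (poly_ring n)" "- a \<in> carrier (poly_ring n)"
          using \<open>a \<in> J\<close> Un by (auto simp: J_def poly_ring_simps)
      qed (simp add: poly_ring_simps)
      ultimately show "\<ominus>\<^bsub>poly_ring n\<^esub> a \<in> J" by simp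
    next
      fix a b assume "a \<in> J" "b \<in> J"
      then show "a \<oplus>\<^bsub>poly_ring n\<^esub> b \<in> J"
        using keys_add[of a b] by (auto simp: J_def poly_ring_simps)
    qed
  qed (use mult in \<open>auto simp: poly_ring_simps mult.commute\<close>)
  moreover have "pmonom ` M \<subseteq> J"
  proof -
    have "a \<in> U" if "a \<in> M" for a
    proof -
      have "a = a + 0" by simp
      then show ?thesis unfolding U_def using that zero_in_monomials[of n] by blast
    qed
    then show ?thesis by (auto simp: J_def pmonom_def)
  qed
  ultimately have "I \<subseteq> J" unfolding M(2) by (rule genideal_minimal)
  then have "m \<in> U" using p by (auto simp: J_def)
  then obtain a b where ab: "m = a + b" "a \<in> M" "b \<in> monomials n" unfolding U_def by blast
  have "pmonom ` M \<subseteq> I"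
    unfolding M(2) using M(1) pmonom_in_carrier by (intro genideal_self) blast
  then show ?thesis using ideal_multiples_mem[OF idI] ab by blast
qed

section \<open>The exchange property of Borel-fixed ideals\<close>

lemma addrow_mat_in_borel_group:
  assumes "i < j" "j < n"
  shows "addrow_mat n 1 i j \<in> borel_group n"
proof -
  have ij: "i < n" "i \<noteq> j" using assms by auto
  have "addrow_mat n 1 i j * addrow_mat n (- 1 :: 'a) i j = 1\<^sub>m n"
    using addrow_mat_inv[OF ij(1) assms(2) ij(2), of 1] .
  moreover have "addrow_mat n (- 1 :: 'a) i j * addrow_mat n 1 i j = 1\<^sub>m n"
    using addrow_mat_inv[OF ij(1) assms(2) ij(2), of "- 1"] by simp
  ultimately have "invertible_mat (addrow_mat n (1::'a) i j)"
    unfolding invertible_mat_def inverts_mat_def by auto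
  then show ?thesis
    using assms unfolding borel_group_def by (auto simp: upper_triangular_def)
qed

lemma prod_pvar_power:
  assumes "finite A"
  shows "(\<Prod>q\<in>A. (pvar q :: 'a::field mpoly) ^ f q) = pmonom (\<Sum>q\<in>A. Poly_Mapping.single q (f q))"
proof -
  have power: "(pvar q :: 'a mpoly) ^ k = pmonom (Poly_Mapping.single q k)" for q k
    by (induction k) (simp_all add: pvar_def pmonom_def mult_single flip: single_add)
  show ?thesis
    using assms by (induction A rule: finite_induct) (simp_all add: power pmonom_def mult_single)
qed

lemma pvar_power: "(pvar q :: 'a::field mpoly) ^ k = pmonom (Poly_Mapping.single q k)"
  using prod_pvar_power[of "{q}" "\<lambda>_. k"] by simp

text \<open>
  In the binomial expansion, the term in which every factor contributes \<open>x\<^sub>i\<close> is the only one without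
  \<open>x\<^sub>j\<close> from the power, and its coefficient is \<open>1\<close>, which does not vanish in any characteristic.
\<close>

lemma keys_elementary_substitution:
  fixes r :: monomial
  assumes "i \<noteq> j"
  shows "r + Poly_Mapping.single i b
    \<in> Poly_Mapping.keys ((pvar j + pvar i) ^ b * (pmonom r :: 'a::field mpoly))"
proof -
  have "(pvar j + pvar i) ^ b * (pmonom r :: 'a mpoly)
    = (\<Sum>k\<le>b. of_nat (b choose k) * pvar j ^ k * pvar i ^ (b - k)) * pmonom r"
    by (simp add: binomial_ring)
  also have "\<dots> = (\<Sum>k\<le>b. Poly_Mapping.single
      (Poly_Mapping.single j k + Poly_Mapping.single i (b - k) + r) (of_nat (b choose k)))"
    unfolding sum_distrib_right single_of_nat[symmetric] pvar_power pmonom_def mult_single by simp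
  finally have eq: "(pvar j + pvar i) ^ b * (pmonom r :: 'a mpoly) = \<dots>" .
  have "Poly_Mapping.single j k + Poly_Mapping.single i (b - k) + r = r + Poly_Mapping.single i b
    \<longleftrightarrow> k = 0" if "k \<le> b" for k
  proof
    assume "Poly_Mapping.single j k + Poly_Mapping.single i (b - k) + r = r + Poly_Mapping.single i b"
    from arg_cong[OF this, of "\<lambda>m. Poly_Mapping.lookup m j"] show "k = 0"
      using assms by (simp add: lookup_add lookup_single)
  qed (simp add: add.commute)
  then have "Poly_Mapping.lookup ((pvar j + pvar i) ^ b * (pmonom r :: 'a mpoly))
      (r + Poly_Mapping.single i b) = (\<Sum>k\<le>b. of_nat (b choose k) when k = 0)"
    unfolding eq lookup_sum lookup_single by (intro sum.cong) auto
  also have "\<dots> = 1" by (simp add: when_def)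
  finally show ?thesis by (simp add: in_keys_iff)
qed

text \<open>
  The elementary matrix substitutes \<open>x\<^sub>j + x\<^sub>i\<close> for \<open>x\<^sub>j\<close> and fixes the other variables; the shift of
  the indices by one comes from matrix entries being numbered from \<open>0\<close>.
\<close>

lemma borel_act_elementary:
  assumes ij: "1 \<le> i" "i < j" "j \<le> n"
    and r: "r \<in> monomials n" "Poly_Mapping.lookup r j = 0"
  shows "borel_act (addrow_mat n 1 (i - 1) (j - 1)) (pmonom (r + Poly_Mapping.single j b))
    = (pvar j + pvar i) ^ b * (pmonom r :: 'a::field mpoly)"
proof -
  define g :: "'a mat" where "g = addrow_mat n 1 (i - 1) (j - 1)"
  define m where "m = r + Poly_Mapping.single j b"
  define X where "X q = (\<Sum>l\<in>{1..q}. pconst (g $$ (l - 1, q - 1)) * pvar l)" for q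
  have entry: "g $$ (l - 1, q - 1) = (if l = q \<or> l = i \<and> q = j then 1 else 0)"
    if "l \<in> {1..q}" "q \<in> {1..n}" for l q
  proof -
    have "l - 1 < n" "q - 1 < n" using that by auto
    then have "g $$ (l - 1, q - 1) = (if i - 1 = l - 1 \<and> j - 1 = q - 1 then (+) 1 else id)
        (if l - 1 = q - 1 then 1 else 0)"
      unfolding g_def by simp
    moreover have "i - 1 = l - 1 \<longleftrightarrow> i = l" "j - 1 = q - 1 \<longleftrightarrow> j = q" "l - 1 = q - 1 \<longleftrightarrow> l = q"
      using that ij by auto
    ultimately show ?thesis using ij by auto
  qed
  have X: "X q = pvar q + (if q = j then pvar i else 0)" if "q \<in> {1..n}" for q
  proof -
    have "X q = (\<Sum>l\<in>{1..q}. (if l = q then pvar q else 0) + (if l = i \<and> q = j then pvar i else 0))"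
      unfolding X_def using that ij entry
      by (intro sum.cong refl) (auto simp: pconst_def)
    also have "\<dots> = pvar q + (if q = j then pvar i else 0)"
      using that ij by (cases "q = j") (simp_all add: sum.distrib)
    finally show ?thesis .
  qed
  have mn: "Poly_Mapping.keys m \<subseteq> {1..n}"
    using r ij keys_add[of r "Poly_Mapping.single j b"]
    by (auto simp: m_def monomials_def split: if_splits)
  have "borel_act g (pmonom m) = (\<Prod>q\<in>Poly_Mapping.keys m. X q ^ Poly_Mapping.lookup m q)"
    unfolding borel_act_def X_def by (simp add: pmonom_def pconst_def)
  also have "\<dots> = (\<Prod>q\<in>{1..n}. X q ^ Poly_Mapping.lookup m q)"
    using mn by (intro prod.mono_neutral_left) (auto simp: in_keys_iff)
  also have "\<dots> = X j ^ Poly_Mapping.lookup m j * (\<Prod>q\<in>{1..n} - {j}. X q ^ Poly_Mapping.lookup m q)"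
    using ij by (subst prod.remove[of _ j]) auto
  also have "(\<Prod>q\<in>{1..n} - {j}. X q ^ Poly_Mapping.lookup m q)
    = (\<Prod>q\<in>{1..n} - {j}. pvar q ^ Poly_Mapping.lookup r q)"
    by (intro prod.cong refl) (auto simp: X m_def lookup_add lookup_single)
  also have "\<dots> = pmonom (\<Sum>q\<in>{1..n} - {j}. Poly_Mapping.single q (Poly_Mapping.lookup r q))"
    by (simp add: prod_pvar_power)
  also have "(\<Sum>q\<in>{1..n} - {j}. Poly_Mapping.single q (Poly_Mapping.lookup r q))
    = (\<Sum>q\<in>Poly_Mapping.keys r. Poly_Mapping.single q (Poly_Mapping.lookup r q))"
    using r by (intro sum.mono_neutral_right) (auto simp: monomials_def in_keys_iff)
  also have "\<dots> = r" by (rule sum_single_keys)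
  finally show ?thesis
    using ij r X[of j] by (simp add: g_def m_def lookup_add)
qed

text \<open>
  All of the exponent of \<open>x\<^sub>j\<close> can be transferred to a smaller variable. Transferring only a part of it
  need not stay inside \<open>I\<close> in positive characteristic: the ideal \<open>(x\<^sub>1\<^sup>2, x\<^sub>2\<^sup>2)\<close> is
  Borel-fixed in characteristic \<open>2\<close> but does not contain \<open>x\<^sub>1x\<^sub>2\<close>.
\<close>

lemma borel_fixed_exchange:
  fixes I :: "'a::field mpoly set"
  assumes I: "borel_fixed n I"
    and ij: "1 \<le> i" "i < j" "j \<le> n"
    and r: "r \<in> monomials n" "Poly_Mapping.lookup r j = 0"
    and mem: "pmonom (r + Poly_Mapping.single j b) \<in> I"
  shows "pmonom (r + Poly_Mapping.single i b) \<in> I"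
proof (rule monomial_ideal_keys_mem)
  show "monomial_ideal n I" using I by (simp add: borel_fixed_def)
  have "addrow_mat n (1::'a) (i - 1) (j - 1) \<in> borel_group n"
    using ij by (intro addrow_mat_in_borel_group) auto
  then have "borel_act (addrow_mat n 1 (i - 1) (j - 1)) (pmonom (r + Poly_Mapping.single j b)) \<in> I"
    using I mem unfolding borel_fixed_def by blast
  then show "(pvar j + pvar i) ^ b * pmonom r \<in> I"
    using borel_act_elementary[OF ij r] by metis
qed (use ij in \<open>simp add: keys_elementary_substitution\<close>)

section \<open>The dimension of a graded piece modulo a monomial ideal\<close>

lemma subfield_pconst: "subfield (range pconst) (poly_ring n :: 'a::field mpoly ring)"
proof -
  interpret cring "poly_ring n :: 'a mpoly ring" by (rule cring_poly_ring)
  let ?K = "range (pconst :: 'a \<Rightarrow> 'a mpoly)"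
  have closed: "- pconst c = pconst (- c)" "pconst c + pconst d = pconst (c + d)"
    "pconst c * pconst d = pconst (c * d)" "1 = pconst 1" "0 = pconst 0" for c d :: 'a
    by (simp_all add: pconst_def single_uminus single_add mult_single)
  have carr: "pconst c \<in> carrier (poly_ring n)" for c :: 'a
    by (simp add: poly_ring_simps pconst_def zero_in_monomials)
  have "subring ?K (poly_ring n)"
  proof (rule subringI)
    fix h assume "h \<in> ?K"
    then obtain c where c: "h = pconst c" by blast
    have "\<ominus>\<^bsub>poly_ring n\<^esub> h = pconst (- c)"
      unfolding c by (rule minus_equality) (auto simp: carr poly_ring_simps(3,5) closed(2) closed(5))
    then show "\<ominus>\<^bsub>poly_ring n\<^esub> h \<in> ?K" by simp
  qed (use carr in \<open>auto simp: poly_ring_simps(2-5) closed\<close>)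
  then have "subcring ?K (poly_ring n)"
    by (rule subcringI) (auto simp: poly_ring_simps mult.commute)
  moreover have "Units ((poly_ring n :: 'a mpoly ring)\<lparr>carrier := ?K\<rparr>) = ?K - {\<zero>\<^bsub>poly_ring n\<^esub>}"
  proof -
    have "pconst (inverse c) * pconst c = 1" "pconst c * pconst (inverse c) = 1" if "pconst c \<noteq> 0" for c :: 'a
    proof -
      have "c \<noteq> 0" using that closed(5) by metis
      then show "pconst (inverse c) * pconst c = 1" "pconst c * pconst (inverse c) = 1"
        by (simp_all add: closed(3) closed(4) del: closed(4)[symmetric])
    qed
    moreover have "(0 :: 'a mpoly) \<noteq> 1" by simp
    ultimately show ?thesis
      unfolding Units_def by (auto simp: poly_ring_simps)
  qed
  ultimately show ?thesis by (rule subfieldI)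
qed

lemma Span_pmonom:
  assumes "set ms \<subseteq> monomials n"
  shows "ring.Span (poly_ring n) (range pconst) (map pmonom ms)
    = {p :: 'a::field mpoly. Poly_Mapping.keys p \<subseteq> set ms}"
  using assms
proof (induction ms)
  interpret cring "poly_ring n :: 'a mpoly ring" by (rule cring_poly_ring)
  case Nil
  then show ?case by (simp add: poly_ring_simps)
next
  interpret cring "poly_ring n :: 'a mpoly ring" by (rule cring_poly_ring)
  case (Cons m ms)
  have IH: "Span (range pconst) (map pmonom ms) = {p :: 'a mpoly. Poly_Mapping.keys p \<subseteq> set ms}"
    using Cons by simp
  have "Span (range pconst) (map pmonom (m # ms))
    = line_extension (range pconst) (pmonom m) {p :: 'a mpoly. Poly_Mapping.keys p \<subseteq> set ms}"
    using IH by simp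
  also have "\<dots> = {p. Poly_Mapping.keys p \<subseteq> set (m # ms)}"
  proof (rule Set.set_eqI)
    fix p :: "'a mpoly"
    have "p \<in> line_extension (range pconst) (pmonom m) {p. Poly_Mapping.keys p \<subseteq> set ms}
      \<longleftrightarrow> (\<exists>c v. Poly_Mapping.keys v \<subseteq> set ms \<and> p = Poly_Mapping.single m c + v)"
      by (auto simp: line_extension_mem_iff poly_ring_simps pconst_def pmonom_def mult_single)
    also have "\<dots> \<longleftrightarrow> Poly_Mapping.keys p \<subseteq> set (m # ms)"
    proof
      assume "\<exists>c v. Poly_Mapping.keys v \<subseteq> set ms \<and> p = Poly_Mapping.single m c + v"
      then obtain c v where "Poly_Mapping.keys v \<subseteq> set ms" "p = Poly_Mapping.single m c + v" by blast
      then show "Poly_Mapping.keys p \<subseteq> set (m # ms)"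
        using keys_add[of "Poly_Mapping.single m c" v] by (auto split: if_splits)
    next
      assume p: "Poly_Mapping.keys p \<subseteq> set (m # ms)"
      define v where "v = p - Poly_Mapping.single m (Poly_Mapping.lookup p m)"
      have "Poly_Mapping.keys v \<subseteq> set ms"
        using p by (auto simp: v_def in_keys_iff lookup_minus lookup_single when_def split: if_splits)
      moreover have "p = Poly_Mapping.single m (Poly_Mapping.lookup p m) + v" by (simp add: v_def)
      ultimately show "\<exists>c v. Poly_Mapping.keys v \<subseteq> set ms \<and> p = Poly_Mapping.single m c + v" by blast
    qed
    finally show "p \<in> line_extension (range pconst) (pmonom m) {p. Poly_Mapping.keys p \<subseteq> set ms}
      \<longleftrightarrow> p \<in> {p. Poly_Mapping.keys p \<subseteq> set (m # ms)}" by simp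
  qed
  finally show ?case .
qed

lemma independent_pmonom:
  assumes "set ms \<subseteq> monomials n" "distinct ms"
  shows "ring.independent (poly_ring n :: 'a::field mpoly ring) (range pconst) (map pmonom ms)"
  using assms
proof (induction ms)
  interpret cring "poly_ring n :: 'a mpoly ring" by (rule cring_poly_ring)
  case Nil
  then show ?case by simp
next
  interpret cring "poly_ring n :: 'a mpoly ring" by (rule cring_poly_ring)
  case (Cons m ms)
  have "pmonom m \<notin> Span (range pconst) (map pmonom ms :: 'a mpoly list)"
    using Cons.prems by (subst Span_pmonom) (auto simp: pmonom_def)
  then show ?case using Cons pmonom_in_carrier[of m n] by (auto intro: li_Cons)
qed

lemma mdeg_eq_sum_superset:
  assumes "finite A" "Poly_Mapping.keys m \<subseteq> A"
  shows "mdeg m = sum (Poly_Mapping.lookup m) A"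
  using assms unfolding mdeg_def by (intro sum.mono_neutral_left) (auto simp: in_keys_iff)

lemma mdeg_eq_sum: "m \<in> monomials n \<Longrightarrow> mdeg m = sum (Poly_Mapping.lookup m) {1..n}"
  by (intro mdeg_eq_sum_superset) (auto simp: monomials_def)

lemma mdeg_plus: "mdeg (a + b) = mdeg a + mdeg b"
proof -
  let ?A = "Poly_Mapping.keys a \<union> Poly_Mapping.keys b"
  have "mdeg (a + b) = sum (Poly_Mapping.lookup (a + b)) ?A"
    by (intro mdeg_eq_sum_superset keys_add) simp
  also have "\<dots> = sum (Poly_Mapping.lookup a) ?A + sum (Poly_Mapping.lookup b) ?A"
    by (simp add: lookup_add sum.distrib)
  also have "\<dots> = mdeg a + mdeg b"
    by (simp add: mdeg_eq_sum_superset[of ?A])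
  finally show ?thesis .
qed

lemma mdeg_single: "mdeg (Poly_Mapping.single q k) = k"
  by (simp add: mdeg_def)

lemma finite_monomials_of_degree: "finite {m \<in> monomials n. mdeg m = t}"
proof (cases "\<exists>m\<^sub>0 \<in> monomials n. mdeg m\<^sub>0 = t")
  case True
  then obtain m\<^sub>0 where m\<^sub>0: "m\<^sub>0 \<in> monomials n" "mdeg m\<^sub>0 = t" by blast
  have "Poly_Mapping.lookup m \<in> redistributions UNIV (Poly_Mapping.lookup m\<^sub>0) {1..n}"
    if "m \<in> monomials n" "mdeg m = t" for m
  proof -
    have "Poly_Mapping.lookup w x = 0" if "w \<in> monomials n" "x \<notin> {1..n}" for w x
      using that by (auto simp: monomials_def in_keys_iff subset_iff)
    then show ?thesis
      using that m\<^sub>0 mdeg_eq_sum[of m n] mdeg_eq_sum[of m\<^sub>0 n] by (simp add: redistributions_def)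
  qed
  then have "Poly_Mapping.lookup ` {m \<in> monomials n. mdeg m = t}
    \<subseteq> redistributions UNIV (Poly_Mapping.lookup m\<^sub>0) {1..n}"
    by blast
  then have "finite (Poly_Mapping.lookup ` {m \<in> monomials n. mdeg m = t})"
    using finite_redistributions finite_subset by blast
  then show ?thesis
    by (rule finite_imageD) (metis inj_onI poly_mapping_eqI)
next
  case False
  then have "{m \<in> monomials n. mdeg m = t} = {}" by blast
  then show ?thesis by (metis finite.emptyI)
qed

text \<open>
  The span \<open>W\<close> of the monomials of degree \<open>t\<close> outside \<open>I\<close> meets \<open>I\<close> only in \<open>0\<close>, since all monomials
  of an element of \<open>I\<close> lie in \<open>I\<close>; so \<open>W\<close> embeds in the quotient. Its image is everything,
  because the monomials in \<open>I\<close> can be dropped from a polynomial without changing its class.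
\<close>

lemma quot_dim_monomial_ideal:
  fixes I :: "'a::field mpoly set"
  assumes I: "monomial_ideal n I" and proper: "I \<subset> carrier (poly_ring n)"
  shows "quot_dim n I t = card {m \<in> monomials n. mdeg m = t \<and> pmonom m \<notin> I}"
proof -
  define D where "D = {m \<in> monomials n. mdeg m = t \<and> pmonom m \<notin> I}"
  have "finite D"
    unfolding D_def by (rule finite_subset[OF _ finite_monomials_of_degree[of n t]]) auto
  then obtain ms where ms: "set ms = D" "distinct ms" using finite_distinct_list by blast
  have msn: "set ms \<subseteq> monomials n" using ms D_def by auto
  interpret R: cring "poly_ring n :: 'a mpoly ring" by (rule cring_poly_ring)
  interpret I: ideal I "poly_ring n" using I by (rule monomial_ideal_is_ideal)
  define h where "h = (+>\<^bsub>poly_ring n\<^esub>) I"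
  interpret h: ring_hom_ring "poly_ring n" "poly_ring n Quot I" h
    unfolding h_def by (rule I.rcos_ring_hom_ring)
  let ?S = "poly_ring n Quot I"
  let ?K = "range pconst :: 'a mpoly set"
  let ?Us = "map pmonom ms :: 'a mpoly list"
  have Us: "set ?Us \<subseteq> carrier (poly_ring n)" using msn pmonom_in_carrier by auto
  have h0: "h p = \<zero>\<^bsub>?S\<^esub> \<longleftrightarrow> p \<in> I" if "p \<in> carrier (poly_ring n)" for p
  proof -
    have "\<zero>\<^bsub>?S\<^esub> = I" by (simp add: FactRing_def)
    then show ?thesis unfolding h_def
      using that I.a_rcos_const R.a_coset_join1 I.a_rcos_self
      by metis
  qed
  have one: "\<one>\<^bsub>?S\<^esub> \<noteq> \<zero>\<^bsub>?S\<^esub>"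
    using h0[of "\<one>\<^bsub>poly_ring n\<^esub>"] I.one_imp_carrier proper by auto
  have K: "subfield ?K (poly_ring n)" by (rule subfield_pconst)
  have Span: "R.Span ?K ?Us = {p. Poly_Mapping.keys p \<subseteq> D}"
    unfolding ms(1)[symmetric] by (rule Span_pmonom[OF msn])
  have trivial: "p = 0" if "p \<in> I" "Poly_Mapping.keys p \<subseteq> D" for p
  proof -
    have "Poly_Mapping.keys p = {}"
      using monomial_ideal_keys_mem[OF I that(1)] that(2) unfolding D_def by blast
    then show ?thesis by simp
  qed
  have inj: "inj_on h (R.Span ?K ?Us)"
  proof (rule inj_onI)
    fix p q assume pq: "p \<in> R.Span ?K ?Us" "q \<in> R.Span ?K ?Us" "h p = h q"
    have carr: "p \<in> carrier (poly_ring n)" "q \<in> carrier (poly_ring n)"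
      using pq R.Span_in_carrier[OF subfieldE(3)[OF K] Us] by auto
    have mem: "p \<ominus>\<^bsub>poly_ring n\<^esub> q \<in> R.Span ?K ?Us"
      using R.Span_subgroup_props(3,4)[OF K Us] pq unfolding a_minus_def by blast
    have "h (p \<ominus>\<^bsub>poly_ring n\<^esub> q) = h p \<ominus>\<^bsub>?S\<^esub> h q"
      using carr unfolding a_minus_def by simp
    also have "\<dots> = \<zero>\<^bsub>?S\<^esub>" using pq carr by (simp add: h.S.r_right_minus_eq)
    finally have "p \<ominus>\<^bsub>poly_ring n\<^esub> q \<in> I" using h0 carr by simp
    then have "p \<ominus>\<^bsub>poly_ring n\<^esub> q = \<zero>\<^bsub>poly_ring n\<^esub>"
      using trivial mem unfolding Span by (simp add: poly_ring_simps)
    then show "p = q" using carr by simp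
  qed
  have "h ` R.Span ?K ?Us = h ` homog n t"
    unfolding Span
  proof (intro equalityI subsetI)
    fix y assume "y \<in> h ` {p. Poly_Mapping.keys p \<subseteq> D}"
    then show "y \<in> h ` homog n t" using D_def by (fastforce simp: homog_def poly_ring_simps)
  next
    fix y assume "y \<in> h ` homog n t"
    then obtain p where p: "p \<in> homog n t" "y = h p" by blast
    \<comment> \<open>\<open>q\<close> is \<open>p\<close> with the terms in \<open>I\<close> removed\<close>
    define q where "q = (\<Sum>m\<in>Poly_Mapping.keys p \<inter> D. Poly_Mapping.single m (Poly_Mapping.lookup p m))"
    have lookup_q: "Poly_Mapping.lookup q m = (Poly_Mapping.lookup p m when m \<in> D)" for m
      by (cases "m \<in> Poly_Mapping.keys p")
        (auto simp: q_def lookup_sum lookup_single when_def in_keys_iff)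
    have qD: "Poly_Mapping.keys q \<subseteq> D" by (auto simp: in_keys_iff lookup_q when_def split: if_splits)
    have carr: "p \<in> carrier (poly_ring n)" "q \<in> carrier (poly_ring n)"
      using p qD by (auto simp: homog_def poly_ring_simps D_def)
    have "p - q \<in> I"
    proof (rule ideal_mem_if_monomials_mem[OF I.ideal_axioms])
      have keys: "m \<in> Poly_Mapping.keys p - D" if "m \<in> Poly_Mapping.keys (p - q)" for m
        using that by (auto simp: in_keys_iff lookup_minus lookup_q when_def split: if_splits)
      then show "p - q \<in> carrier (poly_ring n)" using carr by (auto simp: poly_ring_simps)
      show "pmonom m \<in> I" if "m \<in> Poly_Mapping.keys (p - q)" for m
        using keys[OF that] p unfolding D_def homog_def by (auto simp: poly_ring_simps)
    qed
    moreover have "p = (p - q) \<oplus>\<^bsub>poly_ring n\<^esub> q" by (simp add: poly_ring_simps)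
    ultimately have "h p = \<zero>\<^bsub>?S\<^esub> \<oplus>\<^bsub>?S\<^esub> h q"
      using h0[of "p - q"] carr h.hom_add[of "p - q" q] I.Icarr by metis
    then have "h p = h q" using carr by simp
    then show "y \<in> h ` {p. Poly_Mapping.keys p \<subseteq> D}" using p qD by blast
  qed
  moreover have "h.S.dimension (length (map h ?Us)) (h ` ?K) (h.S.Span (h ` ?K) (map h ?Us))"
    using h.S.dimension_independent[OF h.inj_hom_preserves_independent[OF K one inj]]
      independent_pmonom[OF msn ms(2)] by blast
  moreover have "h.S.Span (h ` ?K) (map h ?Us) = h ` R.Span ?K ?Us"
    using h.Span_hom[OF subfieldE(3)[OF K] Us] .
  ultimately have dim: "h.S.dimension (length ms) (h ` ?K) (h ` homog n t)" by (metis length_map)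
  have "quot_dim n I t = h.S.dim (h ` ?K) (h ` homog n t)"
    unfolding quot_dim_def h_def image_image ..
  also have "\<dots> = length ms"
    using h.S.dimI[OF h.img_is_subfield(2)[OF K one] dim] by (simp add: over_def)
  also have "\<dots> = card D" using ms distinct_card by metis
  finally show ?thesis unfolding D_def .
qed

section \<open>Reductions generated by the last variables\<close>

text \<open>
  Read contrapositively, the exchange property says that the exponents of a monomial outside \<open>I\<close> may
  be spread to later variables that do not occur in it. One monomial outside \<open>I\<close> in the first
  \<open>n - s\<close> variables thus produces many, with the last \<open>s\<close> variables as fresh columns.
\<close>

lemma quot_dim_ge_binomial:
  fixes I :: "'a::field mpoly set"
  assumes I: "borel_fixed n I" "I \<subset> carrier (poly_ring n)" and s: "s \<le> n"
    and m: "m \<in> monomials (n - s)" "pmonom m \<notin> I"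
  shows "(s + mdeg m) choose s \<le> quot_dim n I (mdeg m)"
proof -
  define P where "P = Poly_Mapping.lookup ` {m \<in> monomials n. pmonom m \<notin> I}"
  define A where "A = {1..n - s}"
  define B where "B = {n - s + 1..n}"
  have AB: "A \<union> B = {1..n}" "A \<inter> B = {}" "finite A" "finite B" "card B = s"
    using s unfolding A_def B_def by auto
  have closed: "spread_closed A B P"
    unfolding spread_closed_def
  proof (intro ballI allI impI)
    fix f i j b assume f: "f \<in> P" and i: "i \<in> A" and j: "j \<in> B" and b: "b \<le> f i" "f j = 0"
    obtain w where w: "f = Poly_Mapping.lookup w" "w \<in> monomials n" "pmonom w \<notin> I"
      using f unfolding P_def by blast
    define r where "r = w - Poly_Mapping.single i b"
    have ij: "1 \<le> i" "i < j" "j \<le> n" using i j by (auto simp: A_def B_def)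
    have lookup_r: "Poly_Mapping.lookup r = f(i := f i - b)"
      using b by (auto simp: fun_eq_iff r_def lookup_minus lookup_single w(1))
    have wr: "w = r + Poly_Mapping.single i b"
      using b w(1) by (intro poly_mapping_eqI) (auto simp: lookup_add lookup_r lookup_single when_def)
    then have r: "r \<in> monomials n" using w(2) by (simp add: plus_in_monomials_iff)
    have "pmonom (r + Poly_Mapping.single j b) \<notin> I"
      using borel_fixed_exchange[OF I(1) ij r] b ij w(3) wr lookup_r by auto
    moreover have "r + Poly_Mapping.single j b \<in> monomials n"
      using r ij unfolding plus_in_monomials_iff by (simp add: monomials_def)
    ultimately have "Poly_Mapping.lookup (r + Poly_Mapping.single j b) \<in> P"
      unfolding P_def by blast
    moreover have "Poly_Mapping.lookup (r + Poly_Mapping.single j b) = f(i := f i - b, j := b)"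
      using b ij by (auto simp: fun_eq_iff lookup_add lookup_r lookup_single when_def)
    ultimately show "f(i := f i - b, j := b) \<in> P" by simp
  qed
  have "{1..n - s} \<subseteq> {1..n}" by auto
  then have mn: "m \<in> monomials n" using m(1) unfolding monomials_def by blast
  then have "Poly_Mapping.lookup m \<in> P" using m(2) unfolding P_def by blast
  moreover have "Poly_Mapping.lookup m j = 0" if "j \<in> B" for j
    using m(1) that by (force simp: monomials_def B_def in_keys_iff)
  ultimately have "(card B + sum (Poly_Mapping.lookup m) A) choose card B
      \<le> card (redistributions P (Poly_Mapping.lookup m) (A \<union> B))"
    using AB closed by (intro card_redistributions_ge) auto
  moreover have "mdeg m = sum (Poly_Mapping.lookup m) A"
    using mdeg_eq_sum[OF m(1)] unfolding A_def .
  moreover have "card (redistributions P (Poly_Mapping.lookup m) (A \<union> B))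
    \<le> card {w \<in> monomials n. mdeg w = mdeg m \<and> pmonom w \<notin> I}"
  proof (rule surj_card_le)
    show "finite {w \<in> monomials n. mdeg w = mdeg m \<and> pmonom w \<notin> I}"
      by (rule finite_subset[OF _ finite_monomials_of_degree[of n "mdeg m"]]) auto
    show "redistributions P (Poly_Mapping.lookup m) (A \<union> B)
      \<subseteq> Poly_Mapping.lookup ` {w \<in> monomials n. mdeg w = mdeg m \<and> pmonom w \<notin> I}"
      unfolding AB(1) by (auto simp: redistributions_def P_def mdeg_eq_sum[OF mn] mdeg_eq_sum)
  qed
  moreover have "quot_dim n I (mdeg m) = card {w \<in> monomials n. mdeg w = mdeg m \<and> pmonom w \<notin> I}"
    using I by (intro quot_dim_monomial_ideal) (auto simp: borel_fixed_def)
  ultimately show ?thesis using AB(5) by simp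
qed

lemma exists_divisor_of_degree:
  assumes "d \<le> mdeg m"
  shows "\<exists>a b. m = a + b \<and> mdeg a = d"
  using assms
proof (induction d)
  case 0
  have "m = 0 + m" "mdeg 0 = 0" by (simp_all add: mdeg_def)
  then show ?case by blast
next
  case (Suc d)
  from Suc.prems have "d \<le> mdeg m" by (rule Suc_leD)
  from Suc.IH[OF this] obtain a b where ab: "m = a + b" "mdeg a = d" by blast
  have "b \<noteq> 0"
  proof
    assume "b = 0"
    then have "mdeg m = d" using ab by simp
    then show False using Suc.prems by simp
  qed
  then obtain q where q: "Poly_Mapping.lookup b q \<noteq> 0"
    by (metis lookup_zero poly_mapping_eqI)
  define e where "e = Poly_Mapping.single q (1::nat)"
  have b: "b = e + (b - e)"
    using q by (intro poly_mapping_eqI) (auto simp: e_def lookup_add lookup_minus lookup_single when_def)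
  have "m = (a + e) + (b - e)" using ab(1) b by (metis add.assoc)
  moreover have "mdeg (a + e) = Suc d" using ab(2) by (simp add: mdeg_plus e_def mdeg_single)
  ultimately show ?case by blast
qed

text \<open>
  A monomial either involves one of the last \<open>s\<close> variables, or it has a divisor of degree \<open>t\<close>
  in the first \<open>n - s\<close> variables, which lies in \<open>I\<close>.
\<close>

lemma homog_subset_variables_plus_ideal:
  fixes I :: "'a::field mpoly set"
  assumes I: "ideal I (poly_ring n)"
    and low: "\<And>m. m \<in> monomials (n - s) \<Longrightarrow> mdeg m = t \<Longrightarrow> pmonom m \<in> I"
    and "t \<le> d"
  shows "homog n d \<subseteq> Idl\<^bsub>poly_ring n\<^esub> (pvar ` {n - s + 1..n}) <+>\<^bsub>poly_ring n\<^esub> I"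
proof
  interpret cring "poly_ring n :: 'a mpoly ring" by (rule cring_poly_ring)
  define V where "V = (pvar ` {n - s + 1..n} :: 'a mpoly set)"
  have single: "Poly_Mapping.single j k \<in> monomials n" if "j \<in> {n - s + 1..n}" for j and k :: nat
    using that by (auto simp: monomials_def)
  have V: "V \<subseteq> carrier (poly_ring n)"
    unfolding V_def pvar_def using single by (auto intro!: pmonom_in_carrier)
  have Q: "ideal (Idl\<^bsub>poly_ring n\<^esub> V) (poly_ring n)" using V by (rule genideal_ideal)
  have union: "Idl\<^bsub>poly_ring n\<^esub> V \<union> I \<subseteq> Idl\<^bsub>poly_ring n\<^esub> V <+>\<^bsub>poly_ring n\<^esub> I"
    unfolding union_genideal[OF Q I, symmetric]
    using ideal.Icarr[OF Q] ideal.Icarr[OF I] by (intro genideal_self) blast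
  fix p :: "'a mpoly" assume p: "p \<in> homog n d"
  have "p \<in> Idl\<^bsub>poly_ring n\<^esub> V <+>\<^bsub>poly_ring n\<^esub> I"
  proof (rule ideal_mem_if_monomials_mem)
    show "ideal (Idl\<^bsub>poly_ring n\<^esub> V <+>\<^bsub>poly_ring n\<^esub> I) (poly_ring n)" using Q I by (rule add_ideals)
    show "p \<in> carrier (poly_ring n)" using p by (simp add: homog_def)
    fix m assume "m \<in> Poly_Mapping.keys p"
    then have m: "m \<in> monomials n" "mdeg m = d" using p by (auto simp: homog_def poly_ring_simps)
    show "pmonom m \<in> Idl\<^bsub>poly_ring n\<^esub> V <+>\<^bsub>poly_ring n\<^esub> I"
    proof (cases "m \<in> monomials (n - s)")
      case True
      obtain a b where ab: "m = a + b" "mdeg a = t"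
        using exists_divisor_of_degree[of t m] m assms(3) by auto
      then have "pmonom a \<in> I" using True low by (simp add: plus_in_monomials_iff)
      then have "pmonom m \<in> I"
        using ab m(1) ideal_multiples_mem[OF I] by (simp add: plus_in_monomials_iff)
      then show ?thesis using union by blast
    next
      case False
      then obtain j where j: "j \<in> Poly_Mapping.keys m" "j \<in> {n - s + 1..n}"
        using m(1) by (force simp: monomials_def)
      define e where "e = Poly_Mapping.single j (1::nat)"
      have me: "m = e + (m - e)"
        using j by (intro poly_mapping_eqI)
          (auto simp: e_def lookup_add lookup_minus lookup_single when_def in_keys_iff)
      then have "m - e \<in> monomials n" using m(1) plus_in_monomials_iff by metis
      moreover have "pmonom e \<in> Idl\<^bsub>poly_ring n\<^esub> V"
        using genideal_self[OF V] j(2) unfolding V_def pvar_def e_def by blast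
      ultimately have "pmonom (e + (m - e)) \<in> Idl\<^bsub>poly_ring n\<^esub> V"
        by (intro ideal_multiples_mem[OF Q])
      then show ?thesis using me union by auto
    qed
  qed
  then show "p \<in> Idl\<^bsub>poly_ring n\<^esub> (pvar ` {n - s + 1..n}) <+>\<^bsub>poly_ring n\<^esub> I"
    unfolding V_def .
qed

theorem corollary1p9:
  fixes I :: "'a::field mpoly set" and n s t :: nat
  assumes "infinite (UNIV :: 'a set)"
    and "borel_fixed n I"
    and "I \<subset> carrier (poly_ring n)"
    and "1 \<le> s" and "s \<le> n" and "1 \<le> t"
    and "quot_dim n I t < (s + t) choose t"
  shows "generates_reduction n I (Idl\<^bsub>poly_ring n\<^esub> (pvar ` {n - s + 1..n}))
    \<and> reduction_number n I (Idl\<^bsub>poly_ring n\<^esub> (pvar ` {n - s + 1..n})) \<le> t - 1"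
proof -
  let ?Q = "Idl\<^bsub>poly_ring n\<^esub> (pvar ` {n - s + 1..n}) :: 'a mpoly set"
  have choose_sym: "(s + t) choose t = (s + t) choose s"
    using binomial_symmetric[of s "s + t"] by simp
  have low: "pmonom m \<in> I" if "m \<in> monomials (n - s)" "mdeg m = t" for m
    using quot_dim_ge_binomial[OF assms(2,3,5) that(1)] that(2) assms(7) choose_sym by force
  have "ideal I (poly_ring n)"
    using assms(2) monomial_ideal_is_ideal by (auto simp: borel_fixed_def)
  then have eq: "(?Q <+>\<^bsub>poly_ring n\<^esub> I) \<inter> homog n d = homog n d" if "t \<le> d" for d
    using homog_subset_variables_plus_ideal[OF _ low that] by blast
  have "pvar ` {n - s + 1..n} \<subseteq> (homog n 1 :: 'a mpoly set)"
    by (auto simp: homog_def poly_ring_simps pvar_def pmonom_def monomials_def mdeg_def)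
  then have "generates_reduction n I ?Q"
    unfolding generates_reduction_def using eq by blast
  moreover have "reduction_number n I ?Q \<le> t - 1"
    unfolding reduction_number_def using eq[of t] assms(6) by (intro Least_le) simp
  ultimately show ?thesis by blast
qed

end
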